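(* In the almost observable model of the stochastic clearing system in alternating environment, suppose that $\mu_1=\mu_2$ or $\rho_1=\rho_2$. Then an equilibrium strategy exists within the class of threshold and reverse-threshold strategies. In particular: Case I: if $H^U(0)<0$, the unique equilibrium strategy in the class of threshold and reverse-threshold strategies (reverse-threshold strategies being taken in $\mathcal S_{r-t}=\{\lfloor0\rfloor,\lfloor\infty\rfloor\}\cup\{\lfloor0,\theta_0\rfloor:\theta_0\in(0,1)\}$) is the $\lceil0\rceil\equiv\lfloor\infty\rfloor$ strategy (always balk). Case II: if $H^U(0)=0$, every strategy in the class of threshold and reverse-threshold strategies is an equilibrium strategy. Case III: if $H^U(0)>0$, the unique equilibrium strategy in the class of threshold and reverse-threshold strategies is the $\lceil\infty\rceil\equiv\lfloor0\rfloor$ strategy (always join).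
   Context: Model. $\lambda_1,\lambda_2,\mu_1,\mu_2,q_{12},q_{21},R,C$ are positive reals; $\rho_e=\lambda_e/\mu_e$. The environment is a continuous-time Markov chain on $\{1,2\}$ with rates $q_{12}$ (from 1 to 2) and $q_{21}$ (from 2 to 1). While the environment is $e$, customers arrive as a Poisson process of rate $\lambda_e$ and, independently, a facility visits at rate $\mu_e$ and removes all present customers. A customer who joins gets reward $R$ minus $C$ per unit of time until the next visit; balking gives $0$. Almost observable case. An arriving customer observes the number $n$ of customers present but not the environment. A strategy is a vector $s=(\theta_0,\theta_1,\dots)\in[0,1]^{\mathbb N}$, $\theta_n$ being the probability of joining when $n$ customers are seen. Threshold strategies: $\lceil n_0,\theta\rceil$ ($n_0\in\{0,1,\dots\}$, $\theta\in[0,1]$) has $\theta_i=1$ for $i<n_0$, $\theta_{n_0}=\theta$, $\theta_i=0$ for $i>n_0$; $\lceil n_0\rceil=\lceil n_0,0\rceil$; $\lceil\infty\rceil$ has $\theta_i=1$ for all $i$. Reverse-threshold strategies: $\lfloor n_0,\theta\rfloor$ has $\theta_i=0$ for $i<n_0$, $\theta_{n_0}=\theta$, $\theta_i=1$ for $i>n_0$; $\lfloor n_0\rfloor=\lfloor n_0,1\rfloor$; $\lfloor\infty\rfloor$ has $\theta_i=0$ for all $i$. Thus $\lceil\infty\rceil=\lfloor0\rfloor$ and $\lceil0\rceil=\lfloor\infty\rfloor$. Payoffs. When all customers use $s$, the state (number of customers, environment) is a Markov chain on $\{0,1,\dots\}\times\{1,2\}$ with rates $\lambda_e\theta_n$ for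 $(n,e)\to(n+1,e)$, $\mu_e$ for $(n,e)\to(0,e)$ ($n\ge1$), $q_{12}$ for $(n,1)\to(n,2)$, $q_{21}$ for $(n,2)\to(n,1)$; let $p_{ao}(n,e;s)$ be its stationary distribution. An arriving customer finds $n$ customers with probability $\pi(n;s)=\frac{\lambda_1p_{ao}(n,1;s)+\lambda_2p_{ao}(n,2;s)}{\sum_m(\lambda_1p_{ao}(m,1;s)+\lambda_2p_{ao}(m,2;s))}$. Let $$T_1=\frac{\mu_2+q_{21}+q_{12}}{K},\quad T_2=\frac{\mu_1+q_{21}+q_{12}}{K},\quad K=\mu_1\mu_2+\mu_1q_{21}+\mu_2q_{12}$$ be the mean times to the next visit from environment 1, 2. For $\pi(n;s)>0$, the expected net benefit of joining when seeing $n$ is $$S_{ao}(n;s)=R-C\,\frac{\lambda_1p_{ao}(n,1;s)T_1+\lambda_2p_{ao}(n,2;s)T_2}{\lambda_1p_{ao}(n,1;s)+\lambda_2p_{ao}(n,2;s)}.$$ The payoff of a tagged customer using $(\theta_n')$ against $s$ is $\mathcal U((\theta'_n),s)=\sum_{n:\pi(n;s)>0}\pi(n;s)\,\theta_n'\,S_{ao}(n;s)$. A strategy $s$ is an equilibrium if $\mathcal U(s,s)\ge\mathcal U(s',s)$ for every strategy $s'$. Function $H^U$. $p_E(1)=\frac{q_{21}}{q_{12}+q_{21}}$, $p_E(2)=\frac{q_{12}}{q_{12}+q_{21}}$, $\Delta=[\lambda_2(\mu_1+q_{12})-\lambda_1(\mu_2+q_{21})]^2+4\lambda_1\lambda_2q_{12}q_{21}$,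 $z_{1,2}=\frac{-\lambda_1(\mu_2+q_{21})-\lambda_2(\mu_1+q_{12})\pm\sqrt\Delta}{2\lambda_1\lambda_2}$ ($z_1$ with $+$, $z_2$ with $-$); $A_1=\frac{(\mu_1\lambda_2z_1+K)p_E(1)}{\sqrt\Delta(1-z_1)}$, $B_1=-\frac{(\mu_1\lambda_2z_2+K)p_E(1)}{\sqrt\Delta(1-z_2)}$, $A_2=\frac{(\mu_2\lambda_1z_1+K)p_E(2)}{\sqrt\Delta(1-z_1)}$, $B_2=-\frac{(\mu_2\lambda_1z_2+K)p_E(2)}{\sqrt\Delta(1-z_2)}$; $A=\lambda_1A_1T_1+\lambda_2A_2T_2$, $B=\lambda_1B_1T_1+\lambda_2B_2T_2$, $D=\lambda_1A_1+\lambda_2A_2$, $E=\lambda_1B_1+\lambda_2B_2$; for $n\ge0$, $$H^U(n)=\frac{(RD-CA)\bigl(\frac1{1-z_1}\bigr)^n+(RE-CB)\bigl(\frac1{1-z_2}\bigr)^n}{D\bigl(\frac1{1-z_1}\bigr)^n+E\bigl(\frac1{1-z_2}\bigr)^n}.$$ *)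

theory Defs
  imports "HOL-Probability.Probability"
begin

section \<open>The clearing system in an alternating environment\<close>

datatype env = E1 | E2

record clearing_model =
  lam1 :: real
  lam2 :: real
  mu1 :: real
  mu2 :: real
  q12 :: real
  q21 :: real
  reward :: real
  cost :: real

definition positive_params :: "clearing_model \<Rightarrow> bool" where
  "positive_params M \<longleftrightarrow>
     lam1 M > 0 \<and> lam2 M > 0 \<and> mu1 M > 0 \<and> mu2 M > 0 \<and>
     q12 M > 0 \<and> q21 M > 0 \<and> reward M > 0 \<and> cost M > 0"

fun lam :: "clearing_model \<Rightarrow> env \<Rightarrow> real" where
  "lam M E1 = lam1 M"
| "lam M E2 = lam2 M"

fun mu :: "clearing_model \<Rightarrow> env \<Rightarrow> real" where
  "mu M E1 = mu1 M"
| "mu M E2 = mu2 M"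

fun leave_rate :: "clearing_model \<Rightarrow> env \<Rightarrow> real" where
  "leave_rate M E1 = q12 M"
| "leave_rate M E2 = q21 M"

definition rho :: "clearing_model \<Rightarrow> env \<Rightarrow> real" where
  "rho M e = lam M e / mu M e"


section \<open>Strategies\<close>

type_synonym strategy = "nat \<Rightarrow> real"

definition is_strategy :: "strategy \<Rightarrow> bool" where
  "is_strategy s \<longleftrightarrow> (\<forall>n. 0 \<le> s n \<and> s n \<le> 1)"

text \<open>\<open>threshold n \<theta>\<close> is $\lceil n,\theta\rceil$ and \<open>threshold_inf\<close> is $\lceil\infty\rceil$;
  \<open>rev_threshold n \<theta>\<close> is $\lfloor n,\theta\rfloor$ and \<open>rev_threshold_inf\<close> is
  $\lfloor\infty\rfloor$. The abbreviations $\lceil n\rceil$ and $\lfloor n\rfloor$ stand for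
  \<open>threshold n 0\<close> and \<open>rev_threshold n 1\<close>.\<close>

definition threshold :: "nat \<Rightarrow> real \<Rightarrow> strategy" where
  "threshold n \<theta> = (\<lambda>i. if i < n then 1 else if i = n then \<theta> else 0)"

definition threshold_inf :: strategy where
  "threshold_inf = (\<lambda>i. 1)"

definition rev_threshold :: "nat \<Rightarrow> real \<Rightarrow> strategy" where
  "rev_threshold n \<theta> = (\<lambda>i. if i < n then 0 else if i = n then \<theta> else 1)"

definition rev_threshold_inf :: strategy where
  "rev_threshold_inf = (\<lambda>i. 0)"

definition threshold_strategies :: "strategy set" where
  "threshold_strategies = {threshold n \<theta> | n \<theta>. 0 \<le> \<theta> \<and> \<theta> \<le> 1} \<union> {threshold_inf}"

definition rev_threshold_strategies :: "strategy set" where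
  "rev_threshold_strategies =
     {rev_threshold n \<theta> | n \<theta>. 0 \<le> \<theta> \<and> \<theta> \<le> 1} \<union> {rev_threshold_inf}"

text \<open>The restricted class $\mathcal S_{r-t}$.\<close>

definition S_rt :: "strategy set" where
  "S_rt = {rev_threshold 0 1, rev_threshold_inf} \<union> {rev_threshold 0 \<theta> | \<theta>. 0 < \<theta> \<and> \<theta> < 1}"

lemma threshold_0_eq_rev_threshold_inf: "threshold 0 0 = rev_threshold_inf"
  by (auto simp: threshold_def rev_threshold_inf_def)

lemma threshold_inf_eq_rev_threshold_0: "threshold_inf = rev_threshold 0 1"
  by (auto simp: threshold_inf_def rev_threshold_def)


section \<open>Stationary distribution\<close>

text \<open>\<open>r x y\<close> is the transition rate from \<open>x\<close> to \<open>y\<close>. The condition is $pQ = 0$ for the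
  generator $Q$ with off-diagonal entries \<open>r\<close>. Diagonal values \<open>r x x\<close> would contribute
  equally to both sides.\<close>

definition stationary_distribution :: "('a \<Rightarrow> 'a \<Rightarrow> real) \<Rightarrow> 'a pmf \<Rightarrow> bool" where
  "stationary_distribution r p \<longleftrightarrow>
     (\<forall>x. ((\<lambda>y. pmf p y * r y x) has_sum (pmf p x * (\<Sum>\<^sub>\<infinity>y. r x y))) UNIV)"

definition rate_ao :: "clearing_model \<Rightarrow> strategy \<Rightarrow> nat \<times> env \<Rightarrow> nat \<times> env \<Rightarrow> real" where
  "rate_ao M s = (\<lambda>(n, e) (m, f).
     if m = Suc n \<and> f = e then lam M e * s n
     else if n \<ge> 1 \<and> m = 0 \<and> f = e then mu M e
     else if m = n \<and> f \<noteq> e then leave_rate M e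
     else 0)"

definition p_ao :: "clearing_model \<Rightarrow> strategy \<Rightarrow> (nat \<times> env) pmf" where
  "p_ao M s = (THE p. stationary_distribution (rate_ao M s) p)"


section \<open>Payoffs and equilibria\<close>

definition arrival_weight :: "clearing_model \<Rightarrow> strategy \<Rightarrow> nat \<Rightarrow> real" where
  "arrival_weight M s n =
     lam1 M * pmf (p_ao M s) (n, E1) + lam2 M * pmf (p_ao M s) (n, E2)"

definition arrival_prob :: "clearing_model \<Rightarrow> strategy \<Rightarrow> nat \<Rightarrow> real" where
  "arrival_prob M s n = arrival_weight M s n / (\<Sum>\<^sub>\<infinity>m. arrival_weight M s m)"

definition K :: "clearing_model \<Rightarrow> real" where
  "K M = mu1 M * mu2 M + mu1 M * q21 M + mu2 M * q12 M"

definition T1 :: "clearing_model \<Rightarrow> real" where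
  "T1 M = (mu2 M + q21 M + q12 M) / K M"

definition T2 :: "clearing_model \<Rightarrow> real" where
  "T2 M = (mu1 M + q21 M + q12 M) / K M"

text \<open>Only meaningful where \<open>arrival_prob M s n > 0\<close>.\<close>

definition S_ao :: "clearing_model \<Rightarrow> nat \<Rightarrow> strategy \<Rightarrow> real" where
  "S_ao M n s = reward M - cost M *
     ((lam1 M * pmf (p_ao M s) (n, E1) * T1 M + lam2 M * pmf (p_ao M s) (n, E2) * T2 M) /
      (lam1 M * pmf (p_ao M s) (n, E1) + lam2 M * pmf (p_ao M s) (n, E2)))"

definition payoff :: "clearing_model \<Rightarrow> strategy \<Rightarrow> strategy \<Rightarrow> real" where
  "payoff M s' s =
     (\<Sum>\<^sub>\<infinity>n\<in>{n. arrival_prob M s n > 0}. arrival_prob M s n * s' n * S_ao M n s)"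

definition equilibrium :: "clearing_model \<Rightarrow> strategy \<Rightarrow> bool" where
  "equilibrium M s \<longleftrightarrow>
     is_strategy s \<and> (\<forall>s'. is_strategy s' \<longrightarrow> payoff M s s \<ge> payoff M s' s)"


section \<open>The function \<open>H\<^sup>U\<close>\<close>

definition pE1 :: "clearing_model \<Rightarrow> real" where
  "pE1 M = q21 M / (q12 M + q21 M)"

definition pE2 :: "clearing_model \<Rightarrow> real" where
  "pE2 M = q12 M / (q12 M + q21 M)"

definition Delta :: "clearing_model \<Rightarrow> real" where
  "Delta M = (lam2 M * (mu1 M + q12 M) - lam1 M * (mu2 M + q21 M))^2
             + 4 * lam1 M * lam2 M * q12 M * q21 M"

definition z1 :: "clearing_model \<Rightarrow> real" where
  "z1 M = (- lam1 M * (mu2 M + q21 M) - lam2 M * (mu1 M + q12 M) + sqrt (Delta M))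
          / (2 * lam1 M * lam2 M)"

definition z2 :: "clearing_model \<Rightarrow> real" where
  "z2 M = (- lam1 M * (mu2 M + q21 M) - lam2 M * (mu1 M + q12 M) - sqrt (Delta M))
          / (2 * lam1 M * lam2 M)"

definition A1 :: "clearing_model \<Rightarrow> real" where
  "A1 M = (mu1 M * lam2 M * z1 M + K M) * pE1 M / (sqrt (Delta M) * (1 - z1 M))"

definition B1 :: "clearing_model \<Rightarrow> real" where
  "B1 M = - ((mu1 M * lam2 M * z2 M + K M) * pE1 M / (sqrt (Delta M) * (1 - z2 M)))"

definition A2 :: "clearing_model \<Rightarrow> real" where
  "A2 M = (mu2 M * lam1 M * z1 M + K M) * pE2 M / (sqrt (Delta M) * (1 - z1 M))"

definition B2 :: "clearing_model \<Rightarrow> real" where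
  "B2 M = - ((mu2 M * lam1 M * z2 M + K M) * pE2 M / (sqrt (Delta M) * (1 - z2 M)))"

definition coeff_A :: "clearing_model \<Rightarrow> real" where
  "coeff_A M = lam1 M * A1 M * T1 M + lam2 M * A2 M * T2 M"

definition coeff_B :: "clearing_model \<Rightarrow> real" where
  "coeff_B M = lam1 M * B1 M * T1 M + lam2 M * B2 M * T2 M"

definition coeff_D :: "clearing_model \<Rightarrow> real" where
  "coeff_D M = lam1 M * A1 M + lam2 M * A2 M"

definition coeff_E :: "clearing_model \<Rightarrow> real" where
  "coeff_E M = lam1 M * B1 M + lam2 M * B2 M"

definition H_U :: "clearing_model \<Rightarrow> nat \<Rightarrow> real" where
  "H_U M n =
     ((reward M * coeff_D M - cost M * coeff_A M) * (1 / (1 - z1 M)) ^ n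
      + (reward M * coeff_E M - cost M * coeff_B M) * (1 / (1 - z2 M)) ^ n)
     / (coeff_D M * (1 / (1 - z1 M)) ^ n + coeff_E M * (1 / (1 - z2 M)) ^ n)"

end

theory Submission imports Defs begin

text \<open>
  What an arriving customer learns from the number of customers present is the likelihood of each
  environment, and that matters only through the mean time to the next visit. Under either
  hypothesis the observation is worthless. If $\mu_1=\mu_2$, both environments have the same mean
  visit time. If $\rho_1=\rho_2$, the number of customers and the environment are independent in
  the stationary regime: up to the speed $\mu_e$, the queue process is the same in both
  environments, so the distribution has the product form of \<open>level_product_form\<close>. In both
  cases every queue length that occurs yields the same net benefit of joining, \<open>common_benefit\<close>,
  whatever strategy the population uses (\<open>S_ao_eq_common_benefit\<close>), and $H^U(0)$ is this number
  (\<open>H_U_0_eq_common_benefit\<close>).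

  The payoff of a tagged customer is then \<open>common_benefit\<close> times the probability of joining. If
  this constant is zero, everybody is indifferent. If it is not, a strategy is an equilibrium
  exactly when it joins (or balks) with certainty at every queue length that has positive arrival
  probability (\<open>equilibrium_iff_best_at_arrivals\<close>). Length \<open>0\<close> always has positive
  probability, and so does \<open>n\<close> as soon as all shorter lengths are joined with positive
  probability. Hence a positive constant leaves always joining as the only equilibrium, among all
  strategies. A negative constant forces balking at \<open>0\<close>, after which longer queues never occur;
  in the two classes considered only one strategy balks at \<open>0\<close>.

  All this presupposes that the chain has exactly one stationary distribution for every strategy,
  including those under which some states are transient. The balance equations are recursive in
  the queue length: level \<open>n + 1\<close> receives customers from level \<open>n\<close> only, and each level is a
  nonsingular two-by-two system. The one global term, the inflow into the empty state due to
  visits, is determined once the marginal law of the environment is known, and summing the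
  balance equations over all levels identifies that law. The recursion defines \<open>level\<close>, and
  \<open>stationary_iff_level\<close> says that it is the stationary distribution.
\<close>

section \<open>Balance equations of the chain\<close>

fun other :: "env \<Rightarrow> env" where
  "other E1 = E2"
| "other E2 = E1"

fun env_prob :: "clearing_model \<Rightarrow> env \<Rightarrow> real" where
  "env_prob M E1 = pE1 M"
| "env_prob M E2 = pE2 M"

lemma other_other [simp]: "other (other e) = e"
  by (cases e) auto

lemma other_neq [simp]: "other e \<noteq> e" "e \<noteq> other e"
  by (cases e; simp)+

lemma neq_env_iff: "f \<noteq> e \<longleftrightarrow> f = other e"
  by (cases e; cases f) auto

lemma all_env_iff: "(\<forall>e. P e) \<longleftrightarrow> P E1 \<and> P E2"
  by (metis env.exhaust)

lemma UNIV_env: "UNIV = {E1, E2}"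
  using env.exhaust by auto

text \<open>The rate $\mu_e$ is charged at queue length \<open>0\<close> as well, where a visit changes nothing. With
  this convention, every level has the same balance equation up to its inflow, and the inflow into
  level \<open>0\<close> is $\mu_e$ times the whole probability of environment \<open>e\<close>.\<close>

definition total_rate :: "clearing_model \<Rightarrow> real \<Rightarrow> env \<Rightarrow> real" where
  "total_rate M \<theta> e = lam M e * \<theta> + mu M e + leave_rate M e"

lemma is_strategyD: "is_strategy s \<Longrightarrow> 0 \<le> s n" "is_strategy s \<Longrightarrow> s n \<le> 1"
  by (auto simp: is_strategy_def)

text \<open>Passes between total mass on \<open>nat \<times> env\<close> and series over the queue length. It gives both the
  normalisation of the solution that is constructed and the total mass of an arbitrary one.\<close>

lemma nn_integral_level_env:
  fixes f :: "nat \<times> env \<Rightarrow> real"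
  assumes nonneg: "\<And>x. 0 \<le> f x" and sums: "\<And>e. (\<lambda>n. f (n, e)) sums X e"
  shows "(\<integral>\<^sup>+x. ennreal (f x) \<partial>count_space UNIV) = ennreal (X E1 + X E2)"
proof -
  have "(\<integral>\<^sup>+x. ennreal (f x) \<partial>count_space UNIV)
      = (\<Sum>n. \<integral>\<^sup>+e. ennreal (f (n, e)) \<partial>count_space UNIV)"
    unfolding nn_integral_count_space_nat[symmetric]
    by (rule nn_integral_fst_count_space[of "\<lambda>x. ennreal (f x)", symmetric])
  also have "\<dots> = (\<Sum>n. ennreal (f (n, E1) + f (n, E2)))"
    using nonneg by (simp add: nn_integral_count_space_finite UNIV_env)
  also have "\<dots> = ennreal (X E1 + X E2)"
    using nonneg sums by (intro suminf_ennreal_eq sums_add) auto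
  finally show ?thesis .
qed

definition marginal :: "(nat \<times> env) pmf \<Rightarrow> env \<Rightarrow> real" where
  "marginal p e = (\<Sum>\<^sub>\<infinity>n. pmf p (n, e))"

lemma has_sum_marginal: "((\<lambda>n. pmf p (n, e)) has_sum marginal p e) UNIV"
proof -
  have bound: "(\<Sum>n\<in>F. pmf p (n, e)) \<le> 1" if "finite F" for F
  proof -
    have "(\<Sum>n\<in>F. pmf p (n, e)) = (\<Sum>x\<in>(\<lambda>n. (n, e)) ` F. pmf p x)"
      by (subst sum.reindex) (auto simp: inj_on_def)
    also have "\<dots> = measure_pmf.prob p ((\<lambda>n. (n, e)) ` F)"
      using that by (simp add: measure_measure_pmf_finite)
    finally show ?thesis by simp
  qed
  have "(\<lambda>n. pmf p (n, e)) summable_on UNIV"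
    by (rule nonneg_bounded_partial_sums_imp_summable_on[where C = 1])
      (auto intro!: eventually_finite_subsets_at_top_weakI bound)
  then show ?thesis unfolding marginal_def by (rule has_sum_infsum)
qed

lemma marginal_sums: "(\<lambda>n. pmf p (n, e)) sums marginal p e"
  by (rule has_sum_imp_sums[OF has_sum_marginal])

lemma marginal_total: "marginal p E1 + marginal p E2 = 1"
proof -
  have "ennreal (marginal p E1 + marginal p E2) = 1"
    using nn_integral_level_env[of "pmf p" "marginal p"] marginal_sums
    by (simp add: nn_integral_pmf)
  then show ?thesis by (simp add: ennreal_eq_1)
qed

lemma outflow_ao:
  "(\<Sum>\<^sub>\<infinity>y. rate_ao M s (n, e) y)
     = lam M e * s n + (if n = 0 then 0 else mu M e) + leave_rate M e"
  by (rule infsumI,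
      rule has_sum_finite_neutralI[of
        "{(Suc n, e), (n, other e)} \<union> (if n = 0 then {} else {(0, e)})"])
    (auto simp: rate_ao_def neq_env_iff split: if_splits)

lemma inflow_ao_Suc:
  "((\<lambda>y. pmf p y * rate_ao M s y (Suc n, e)) has_sum
     (lam M e * s n * pmf p (n, e) + leave_rate M (other e) * pmf p (Suc n, other e))) UNIV"
  by (rule has_sum_finite_neutralI[of "{(n, e), (Suc n, other e)}"])
    (auto simp: rate_ao_def neq_env_iff split: if_splits)

text \<open>Visits empty the system from every queue length, so this state has infinitely many
  predecessors. Visits bring in the mass of environment \<open>e\<close> except that of the state itself.\<close>

lemma inflow_ao_0:
  "((\<lambda>y. pmf p y * rate_ao M s y (0, e)) has_sum
     (mu M e * (marginal p e - pmf p (0, e)) + leave_rate M (other e) * pmf p (0, other e))) UNIV"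
proof -
  have "((\<lambda>y. pmf p y) has_sum marginal p e) (range (\<lambda>n. (n, e)))"
    using has_sum_marginal[of p e] by (subst has_sum_reindex) (auto simp: inj_on_def o_def)
  then have env_mass: "((\<lambda>y. if snd y = e then pmf p y else 0) has_sum marginal p e) UNIV"
    by (rule has_sum_cong_neutral[THEN iffD1, rotated -1]) auto
  have point: "((\<lambda>y. if y = x then c else 0) has_sum (c::real)) UNIV" for x :: "nat \<times> env" and c
    by (rule has_sum_finite_neutralI[of "{x}"]) auto
  have "((\<lambda>y. mu M e * (if snd y = e then pmf p y else 0)
        + ((if y = (0, e) then - (mu M e * pmf p (0, e)) else 0)
        + (if y = (0, other e) then leave_rate M (other e) * pmf p (0, other e) else 0))) has_sum
      (mu M e * marginal p e + (- (mu M e * pmf p (0, e))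
        + leave_rate M (other e) * pmf p (0, other e)))) UNIV"
    by (intro has_sum_add has_sum_cmult_right env_mass point)
  also have "?this \<longleftrightarrow> ?thesis"
    by (intro has_sum_cong arg_cong2[where f = "\<lambda>f x. (f has_sum x) UNIV"] ext)
      (auto simp: rate_ao_def neq_env_iff algebra_simps split: if_splits)
  finally show ?thesis .
qed

lemma all_nat_split: "(\<forall>n. P n) \<longleftrightarrow> P 0 \<and> (\<forall>n. P (Suc n))"
  by (metis not0_implies_Suc)

lemma stationary_ao_iff:
  "stationary_distribution (rate_ao M s) p \<longleftrightarrow>
     (\<forall>e. total_rate M (s 0) e * pmf p (0, e)
        = mu M e * marginal p e + leave_rate M (other e) * pmf p (0, other e)) \<and>
     (\<forall>n e. total_rate M (s (Suc n)) e * pmf p (Suc n, e)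
        = lam M e * s n * pmf p (n, e) + leave_rate M (other e) * pmf p (Suc n, other e))"
  (is "_ \<longleftrightarrow> ?balance")
proof -
  have balance_iff: "((\<lambda>y. pmf p y * rate_ao M s y x) has_sum c) UNIV \<longleftrightarrow> c = d"
    if "((\<lambda>y. pmf p y * rate_ao M s y x) has_sum d) UNIV" for x c d
    using that has_sum_unique by blast
  have "stationary_distribution (rate_ao M s) p \<longleftrightarrow>
      (\<forall>n e. ((\<lambda>y. pmf p y * rate_ao M s y (n, e)) has_sum
        pmf p (n, e) * (\<Sum>\<^sub>\<infinity>y. rate_ao M s (n, e) y)) UNIV)"
    by (simp add: stationary_distribution_def split_paired_all)
  also have "\<dots> \<longleftrightarrow>
      (\<forall>e. ((\<lambda>y. pmf p y * rate_ao M s y (0, e)) has_sum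
        pmf p (0, e) * (\<Sum>\<^sub>\<infinity>y. rate_ao M s (0, e) y)) UNIV) \<and>
      (\<forall>n e. ((\<lambda>y. pmf p y * rate_ao M s y (Suc n, e)) has_sum
        pmf p (Suc n, e) * (\<Sum>\<^sub>\<infinity>y. rate_ao M s (Suc n, e) y)) UNIV)"
    by (rule all_nat_split)
  also have "\<dots> \<longleftrightarrow> ?balance"
    unfolding balance_iff[OF inflow_ao_0] balance_iff[OF inflow_ao_Suc] outflow_ao
    by (simp add: total_rate_def algebra_simps)
  finally show ?thesis .
qed

section \<open>The net benefit without information\<close>

text \<open>The net benefit for a customer who arrives in environment \<open>e\<close> with probability proportional to
  $\lambda_e p_E(e)$, that is, who has observed nothing.\<close>

definition common_benefit :: "clearing_model \<Rightarrow> real" where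
  "common_benefit M = reward M - cost M *
     ((lam1 M * pE1 M * T1 M + lam2 M * pE2 M * T2 M) / (lam1 M * pE1 M + lam2 M * pE2 M))"

text \<open>The two hypotheses of the theorem enter through the two alternatives here: equal visit times, or
  proportional weights. The difference of the two means is a multiple of
  $(x_1y_2-x_2y_1)(T-T')$.\<close>

lemma weighted_mean_eq:
  fixes x1 x2 y1 y2 T T' :: real
  assumes "T = T' \<or> x1 * y2 = x2 * y1" "x1 + x2 \<noteq> 0" "y1 + y2 \<noteq> 0"
  shows "(x1 * T + x2 * T') / (x1 + x2) = (y1 * T + y2 * T') / (y1 + y2)"
proof -
  have "(x1 * y2 - x2 * y1) * (T - T') = 0" using assms(1) by auto
  then have "(x1 * T + x2 * T') * (y1 + y2) = (y1 * T + y2 * T') * (x1 + x2)" by algebra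
  then show ?thesis using assms(2,3) by (simp add: frac_eq_eq)
qed

section \<open>One level of the balance equations\<close>

text \<open>The balance of one queue length at which customers join with probability \<open>\<theta>\<close>, where \<open>a e\<close> is
  the inflow that comes neither from this level nor from a change of environment.\<close>

definition level_balance ::
    "clearing_model \<Rightarrow> real \<Rightarrow> (env \<Rightarrow> real) \<Rightarrow> (env \<Rightarrow> real) \<Rightarrow> bool" where
  "level_balance M \<theta> a x \<longleftrightarrow>
     (\<forall>e. total_rate M \<theta> e * x e = a e + leave_rate M (other e) * x (other e))"

text \<open>Cramer's rule for \<open>level_balance\<close>.\<close>

definition level_solution ::
    "clearing_model \<Rightarrow> real \<Rightarrow> (env \<Rightarrow> real) \<Rightarrow> env \<Rightarrow> real" where
  "level_solution M \<theta> a e =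
     (total_rate M \<theta> (other e) * a e + leave_rate M (other e) * a (other e))
     / (total_rate M \<theta> E1 * total_rate M \<theta> E2 - q12 M * q21 M)"

fun level :: "clearing_model \<Rightarrow> strategy \<Rightarrow> nat \<Rightarrow> env \<Rightarrow> real" where
  "level M s 0 = level_solution M (s 0) (\<lambda>e. mu M e * env_prob M e)"
| "level M s (Suc n) = level_solution M (s (Suc n)) (\<lambda>e. lam M e * s n * level M s n e)"

context
  fixes M :: clearing_model
  assumes pos: "positive_params M"
begin

lemma rates_pos:
  "lam M e > 0" "mu M e > 0" "leave_rate M e > 0" "env_prob M e > 0"
  using pos by (cases e; simp add: positive_params_def pE1_def pE2_def)+

lemma total_rate_gt_leave_rate: "0 \<le> \<theta> \<Longrightarrow> leave_rate M e < total_rate M \<theta> e"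
  using rates_pos[of e] by (simp add: total_rate_def add_nonneg_pos)

lemma total_rate_pos: "0 \<le> \<theta> \<Longrightarrow> 0 < total_rate M \<theta> e"
  using total_rate_gt_leave_rate[of \<theta> e] rates_pos(3)[of e] by linarith

text \<open>The system is strictly diagonally dominant by columns because the visit rates are positive.\<close>

lemma level_det_pos:
  assumes "0 \<le> \<theta>"
  shows "0 < total_rate M \<theta> E1 * total_rate M \<theta> E2 - q12 M * q21 M"
proof -
  have "q12 M * q21 M < total_rate M \<theta> E1 * total_rate M \<theta> E2"
    using total_rate_gt_leave_rate[OF assms, of E1] total_rate_gt_leave_rate[OF assms, of E2]
      rates_pos(3)[of E1] rates_pos(3)[of E2]
    by (intro mult_strict_mono) auto
  then show ?thesis by simp
qed

lemma level_balance_iff: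
  assumes "0 \<le> \<theta>"
  shows "level_balance M \<theta> a x \<longleftrightarrow> x = level_solution M \<theta> a"
proof -
  define t1 t2 where t: "t1 = total_rate M \<theta> E1" "t2 = total_rate M \<theta> E2"
  define d where "d = t1 * t2 - q12 M * q21 M"
  have d: "d \<noteq> 0"
    using level_det_pos[OF assms] by (simp add: d_def t)
  have "level_balance M \<theta> a x \<longleftrightarrow>
      t1 * x E1 = a E1 + q21 M * x E2 \<and> t2 * x E2 = a E2 + q12 M * x E1"
    by (simp add: level_balance_def all_env_iff t)
  also have "\<dots> \<longleftrightarrow> x E1 * d = t2 * a E1 + q21 M * a E2 \<and> x E2 * d = t1 * a E2 + q12 M * a E1"
    (is "?L \<longleftrightarrow> ?R")
  proof
    assume ?L then show ?R unfolding d_def by algebra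
  next
    assume R: ?R
    have "(t1 * x E1 - (a E1 + q21 M * x E2)) * d = 0"
         "(t2 * x E2 - (a E2 + q12 M * x E1)) * d = 0"
      using R unfolding d_def by algebra+
    then show ?L using d by simp
  qed
  also have "\<dots> \<longleftrightarrow> x E1 = level_solution M \<theta> a E1 \<and> x E2 = level_solution M \<theta> a E2"
    using d by (simp add: level_solution_def eq_divide_eq flip: t d_def)
  also have "\<dots> \<longleftrightarrow> x = level_solution M \<theta> a"
    by (simp add: fun_eq_iff all_env_iff)
  finally show ?thesis .
qed

lemma level_solution_balance:
  "0 \<le> \<theta> \<Longrightarrow> total_rate M \<theta> e * level_solution M \<theta> a e
     = a e + leave_rate M (other e) * level_solution M \<theta> a (other e)"
  using level_balance_iff[of \<theta> a "level_solution M \<theta> a"] by (simp add: level_balance_def)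

lemma level_solution_nonneg:
  "0 \<le> \<theta> \<Longrightarrow> (\<And>e. 0 \<le> a e) \<Longrightarrow> 0 \<le> level_solution M \<theta> a e"
  using level_det_pos[of \<theta>] total_rate_pos[of \<theta>] rates_pos(3)
  by (auto simp: level_solution_def less_imp_le)

lemma level_solution_pos:
  "0 \<le> \<theta> \<Longrightarrow> (\<And>e. 0 < a e) \<Longrightarrow> 0 < level_solution M \<theta> a e"
  using level_det_pos[of \<theta>] total_rate_pos[of \<theta>] rates_pos(3)
  by (auto simp: level_solution_def intro!: divide_pos_pos add_pos_pos)

lemma env_prob_sum: "env_prob M E1 + env_prob M E2 = 1"
  using pos by (simp add: positive_params_def pE1_def pE2_def divide_simps)

lemma arrival_rate_pos: "0 < lam1 M * pE1 M + lam2 M * pE2 M"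
  using rates_pos(1)[of E1] rates_pos(1)[of E2] rates_pos(4)[of E1] rates_pos(4)[of E2]
  by (simp add: add_pos_pos)

lemma env_prob_balance: "leave_rate M e * env_prob M e = leave_rate M (other e) * env_prob M (other e)"
  by (cases e) (auto simp: pE1_def pE2_def)

text \<open>The stationary law of the environment chain alone: one balance equation and normalisation.\<close>

lemma env_prob_unique:
  assumes "\<And>e. leave_rate M e * X e = leave_rate M (other e) * X (other e)" "X E1 + X E2 = 1"
  shows "X = env_prob M"
proof -
  have q: "q12 M > 0" "q21 M > 0" using pos by (auto simp: positive_params_def)
  have "q12 M * X E1 = q21 M * X E2" using assms(1)[of E1] by simp
  then have "X E1 * (q12 M + q21 M) = q21 M" "X E2 * (q12 M + q21 M) = q12 M"
    using assms(2) by algebra+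
  then have "X E1 = env_prob M E1" "X E2 = env_prob M E2"
    using q by (simp_all add: pE1_def pE2_def eq_divide_eq)
  then show ?thesis by (simp add: fun_eq_iff all_env_iff)
qed

section \<open>The candidate stationary law\<close>

context
  fixes s :: strategy
  assumes strat: "is_strategy s"
begin

lemma s_nonneg: "0 \<le> s n" and s_le_1: "s n \<le> 1"
  using strat by (auto simp: is_strategy_def)

lemma level_nonneg: "0 \<le> level M s n e"
proof (induction n arbitrary: e)
  case 0
  show ?case using rates_pos s_nonneg by (simp add: level_solution_nonneg less_imp_le)
next
  case (Suc n)
  then show ?case using rates_pos s_nonneg by (simp add: level_solution_nonneg less_imp_le)
qed

text \<open>Positivity spreads over both environments of a level, since the environment changes at positive
  rate, and it reaches the next level as long as some arrivals join.\<close>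

lemma level_pos: "(\<And>i. i < n \<Longrightarrow> 0 < s i) \<Longrightarrow> 0 < level M s n e"
proof (induction n arbitrary: e)
  case 0
  show ?case unfolding level.simps
    by (rule level_solution_pos[OF s_nonneg]) (simp add: rates_pos)
next
  case (Suc n)
  then have "0 < s n" "0 < level M s n e" for e by auto
  then show ?case unfolding level.simps
    by (intro level_solution_pos[OF s_nonneg]) (simp add: rates_pos)
qed

lemma level_0_balance:
  "total_rate M (s 0) e * level M s 0 e
     = mu M e * env_prob M e + leave_rate M (other e) * level M s 0 (other e)"
  using level_solution_balance[OF s_nonneg] by simp

lemma level_Suc_balance:
  "total_rate M (s (Suc n)) e * level M s (Suc n) e
     = lam M e * s n * level M s n e + leave_rate M (other e) * level M s (Suc n) (other e)"
  using level_solution_balance[OF s_nonneg] by simp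

text \<open>The flow out of the set of queue lengths up to \<open>n\<close> in environment \<open>e\<close>: everything telescopes
  except the joining customers that leave the set at its upper end.\<close>

lemma level_partial_sum_balance:
  "(mu M e + leave_rate M e) * (\<Sum>i\<le>n. level M s i e) + lam M e * s n * level M s n e
     = mu M e * env_prob M e + leave_rate M (other e) * (\<Sum>i\<le>n. level M s i (other e))"
proof (induction n)
  case 0
  show ?case using level_0_balance[of e] by (simp add: total_rate_def algebra_simps)
next
  case (Suc n)
  then show ?case using level_Suc_balance[of n e] by (simp add: total_rate_def algebra_simps)
qed

text \<open>Adding the partial balances of the two environments cancels the environment changes. What is
  left bounds the $\mu$-weighted mass, hence the mass of each environment.\<close>

lemma level_summable: "summable (\<lambda>n. level M s n e)"
proof (rule bounded_imp_summable)
  fix n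
  define S where "S = (\<lambda>e. \<Sum>i\<le>n. level M s i e)"
  have S: "0 \<le> S e" for e by (simp add: S_def sum_nonneg level_nonneg)
  have eq: "(mu M e + leave_rate M e) * S e + lam M e * s n * level M s n e
     = mu M e * env_prob M e + leave_rate M (other e) * S (other e)" for e
    unfolding S_def by (rule level_partial_sum_balance)
  have nn: "0 \<le> lam M e * s n * level M s n e" for e
    using rates_pos(1)[of e] s_nonneg level_nonneg by simp
  have "mu M e * S e + mu M (other e) * S (other e)
      \<le> mu M e * env_prob M e + mu M (other e) * env_prob M (other e)"
    using eq[of e] eq[of "other e"] nn[of e] nn[of "other e"] by (simp add: algebra_simps)
  moreover have "0 \<le> mu M (other e) * S (other e)"
    using rates_pos(2)[of "other e"] S by simp
  ultimately have "S e * mu M e \<le> mu M e * env_prob M e + mu M (other e) * env_prob M (other e)"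
    by (simp add: mult.commute)
  then show "(\<Sum>i\<le>n. level M s i e)
      \<le> (mu M e * env_prob M e + mu M (other e) * env_prob M (other e)) / mu M e"
    using rates_pos(2)[of e] by (simp add: S_def pos_le_divide_eq)
qed (rule level_nonneg)

text \<open>Along the partial balances the joining term vanishes in the limit, so the two sums solve the
  system of a level with joining probability \<open>0\<close>. The law of the environment solves it too, and
  the solution is unique.\<close>

lemma level_sums: "(\<lambda>n. level M s n e) sums env_prob M e"
proof -
  define X where "X = (\<lambda>e. \<Sum>n. level M s n e)"
  have lim: "(\<lambda>n. \<Sum>i\<le>n. level M s i e) \<longlonglongrightarrow> X e" for e
    unfolding X_def by (rule summable_LIMSEQ'[OF level_summable])
  have join0: "(\<lambda>n. lam M e * (s n * level M s n e)) \<longlonglongrightarrow> 0" for e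
  proof -
    have "(\<lambda>n. s n * level M s n e) \<longlonglongrightarrow> 0"
      by (rule tendsto_sandwich[OF _ _ tendsto_const summable_LIMSEQ_zero[OF level_summable[of e]]])
        (auto intro!: always_eventually mult_left_le_one_le simp: level_nonneg s_nonneg s_le_1)
    from tendsto_mult_left[OF this, of "lam M e"] show ?thesis by simp
  qed
  \<comment> \<open>The limit of the partial balances; a joining probability \<open>0\<close> stands for the vanished term.\<close>
  have "total_rate M 0 e * X e = mu M e * env_prob M e + leave_rate M (other e) * X (other e)" for e
  proof -
    have "(\<lambda>n. (mu M e + leave_rate M e) * (\<Sum>i\<le>n. level M s i e)
          + lam M e * (s n * level M s n e)) \<longlonglongrightarrow> (mu M e + leave_rate M e) * X e + 0"
      by (intro tendsto_intros lim join0)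
    moreover have "(\<lambda>n. mu M e * env_prob M e
          + leave_rate M (other e) * (\<Sum>i\<le>n. level M s i (other e)))
        \<longlonglongrightarrow> mu M e * env_prob M e + leave_rate M (other e) * X (other e)"
      by (intro tendsto_intros lim)
    ultimately show ?thesis
      using level_partial_sum_balance[of e]
      by (auto simp: total_rate_def mult.assoc dest: LIMSEQ_unique)
  qed
  then have "level_balance M 0 (\<lambda>e. mu M e * env_prob M e) X"
    by (simp add: level_balance_def)
  moreover have "level_balance M 0 (\<lambda>e. mu M e * env_prob M e) (env_prob M)"
    using env_prob_balance by (simp add: level_balance_def total_rate_def distrib_right)
  ultimately have "X = env_prob M" by (simp add: level_balance_iff)
  then show ?thesis
    using summable_sums[OF level_summable[of e]] by (simp add: X_def fun_eq_iff)
qed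


section \<open>The stationary distribution\<close>

lemma ex_pmf_level: "\<exists>p. \<forall>n e. pmf p (n, e) = level M s n e"
proof -
  define f where "f = (\<lambda>(n, e). level M s n e)"
  have nonneg: "0 \<le> f x" for x
    by (simp add: f_def level_nonneg split: prod.splits)
  have "(\<integral>\<^sup>+x. ennreal (f x) \<partial>count_space UNIV) = 1"
    using nn_integral_level_env[of f "env_prob M"] nonneg level_sums env_prob_sum
    by (simp add: f_def)
  then have "pmf (embed_pmf f) x = f x" for x
    by (rule pmf_embed_pmf[OF nonneg])
  then have "\<forall>n e. pmf (embed_pmf f) (n, e) = level M s n e"
    by (simp add: f_def)
  then show ?thesis by blast
qed

text \<open>Summing the balance equations over all queue lengths cancels joining and visits, which do not
  change the environment. What remains is the balance equation of the environment alone.\<close>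

lemma stationary_marginal:
  assumes "stationary_distribution (rate_ao M s) p"
  shows "marginal p = env_prob M"
proof (rule env_prob_unique)
  fix e
  have joins: "summable (\<lambda>n. s n * pmf p (n, e))"
    by (rule summable_comparison_test'[OF sums_summable[OF marginal_sums[of p e]], of 0])
      (auto simp: s_nonneg s_le_1 mult_left_le_one_le)
  define J where "J = (\<Sum>n. s n * pmf p (n, e))"
  \<comment> \<open>The outflow of the states of environment \<open>e\<close> is summed twice: from its definition, and from the
    inflows to which stationarity equates it.\<close>
  define out where "out = (\<lambda>n. total_rate M (s n) e * pmf p (n, e))"
  have Suc_sums: "(\<lambda>n. pmf p (Suc n, f)) sums (marginal p f - pmf p (0, f))" for f
    using marginal_sums[of p f] by (subst sums_Suc_iff) simp
  have J: "(\<lambda>n. s n * pmf p (n, e)) sums J"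
    unfolding J_def using joins by (rule summable_sums)
  have "(\<lambda>n. lam M e * (s n * pmf p (n, e)) + (mu M e + leave_rate M e) * pmf p (n, e))
      sums (lam M e * J + (mu M e + leave_rate M e) * marginal p e)"
    by (intro sums_add sums_mult J marginal_sums)
  then have out_sums: "out sums (lam M e * J + (mu M e + leave_rate M e) * marginal p e)"
    by (simp add: out_def total_rate_def algebra_simps)
  have "(\<lambda>n. lam M e * (s n * pmf p (n, e)) + leave_rate M (other e) * pmf p (Suc n, other e))
      sums (lam M e * J
        + leave_rate M (other e) * (marginal p (other e) - pmf p (0, other e)))"
    by (intro sums_add sums_mult J Suc_sums)
  then have "(\<lambda>n. out (Suc n)) sums (lam M e * J
        + leave_rate M (other e) * (marginal p (other e) - pmf p (0, other e)))"
    using assms by (simp add: out_def stationary_ao_iff mult.assoc)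
  then have "out sums (lam M e * J
        + leave_rate M (other e) * (marginal p (other e) - pmf p (0, other e)) + out 0)"
    by (rule sums_Suc)
  from sums_unique2[OF out_sums this]
  have "lam M e * J + (mu M e + leave_rate M e) * marginal p e = lam M e * J
        + leave_rate M (other e) * (marginal p (other e) - pmf p (0, other e)) + out 0" .
  moreover have "out 0 = mu M e * marginal p e + leave_rate M (other e) * pmf p (0, other e)"
    using assms by (simp add: out_def stationary_ao_iff)
  ultimately show
    "leave_rate M e * marginal p e = leave_rate M (other e) * marginal p (other e)"
    by (simp add: algebra_simps)
qed (rule marginal_total)

lemma stationary_iff_level:
  "stationary_distribution (rate_ao M s) p \<longleftrightarrow> (\<forall>n e. pmf p (n, e) = level M s n e)"
proof
  assume stat: "stationary_distribution (rate_ao M s) p"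
  have "(\<lambda>e. pmf p (n, e)) = level M s n" for n
  proof (induction n)
    case 0
    have "level_balance M (s 0) (\<lambda>e. mu M e * env_prob M e) (\<lambda>e. pmf p (0, e))"
      using stat stationary_marginal[OF stat]
      by (simp add: level_balance_def stationary_ao_iff)
    then show ?case by (simp add: level_balance_iff s_nonneg)
  next
    case (Suc n)
    have "level_balance M (s (Suc n)) (\<lambda>e. lam M e * s n * pmf p (n, e)) (\<lambda>e. pmf p (Suc n, e))"
      using stat by (simp add: level_balance_def stationary_ao_iff)
    with Suc show ?case by (simp add: level_balance_iff s_nonneg fun_eq_iff)
  qed
  then show "\<forall>n e. pmf p (n, e) = level M s n e" by (simp add: fun_eq_iff)
next
  assume eq: "\<forall>n e. pmf p (n, e) = level M s n e"
  then have "marginal p e = env_prob M e" for e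
    using sums_unique2[OF marginal_sums[of p e]] level_sums[of e] by simp
  then show "stationary_distribution (rate_ao M s) p"
    using eq level_0_balance level_Suc_balance
    by (simp add: stationary_ao_iff del: level.simps)
qed

lemma pmf_p_ao: "pmf (p_ao M s) (n, e) = level M s n e"
proof -
  obtain p where p: "\<forall>n e. pmf p (n, e) = level M s n e"
    using ex_pmf_level by blast
  have "stationary_distribution (rate_ao M s) (p_ao M s)"
    unfolding p_ao_def
  proof (rule theI)
    show "stationary_distribution (rate_ao M s) p"
      using p by (simp add: stationary_iff_level)
    show "p' = p" if "stationary_distribution (rate_ao M s) p'" for p'
      using that p by (intro pmf_eqI) (simp add: stationary_iff_level split_paired_all)
  qed
  then show ?thesis by (simp add: stationary_iff_level)
qed

section \<open>Arrivals\<close>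

lemma arrival_weight_nonneg: "0 \<le> arrival_weight M s n"
  using rates_pos(1)[of E1] rates_pos(1)[of E2]
  by (simp add: arrival_weight_def pmf_p_ao level_nonneg)

lemma arrival_weight_has_sum:
  "(arrival_weight M s has_sum (lam1 M * pE1 M + lam2 M * pE2 M)) UNIV"
proof (rule sums_nonneg_imp_has_sum[OF _ arrival_weight_nonneg])
  show "arrival_weight M s sums (lam1 M * pE1 M + lam2 M * pE2 M)"
    unfolding arrival_weight_def pmf_p_ao
    using level_sums[of E1] level_sums[of E2] by (intro sums_add sums_mult) auto
qed

lemma arrival_prob_eq: "arrival_prob M s n = arrival_weight M s n / (lam1 M * pE1 M + lam2 M * pE2 M)"
  using infsumI[OF arrival_weight_has_sum] by (simp add: arrival_prob_def)

lemma arrival_prob_nonneg: "0 \<le> arrival_prob M s n"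
  using arrival_weight_nonneg arrival_rate_pos by (simp add: arrival_prob_eq)

lemma arrival_prob_summable: "arrival_prob M s summable_on UNIV"
proof -
  have "arrival_prob M s =
      (\<lambda>n. inverse (lam1 M * pE1 M + lam2 M * pE2 M) * arrival_weight M s n)"
    by (rule ext) (simp add: arrival_prob_eq divide_inverse mult.commute)
  then show ?thesis
    using has_sum_cmult_right[OF arrival_weight_has_sum] by (auto simp: summable_on_def)
qed

text \<open>A queue length occurs if every shorter one is joined with positive probability, since the state
  is then reachable from the empty system.\<close>

lemma arrival_prob_pos:
  assumes "\<And>i. i < n \<Longrightarrow> 0 < s i"
  shows "0 < arrival_prob M s n"
  using level_pos[OF assms] rates_pos(1)[of E1] rates_pos(1)[of E2] arrival_rate_pos
  by (simp add: arrival_prob_eq arrival_weight_def pmf_p_ao add_pos_pos)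


end

section \<open>The net benefit of joining is constant\<close>

context
  assumes sym: "mu M E1 = mu M E2 \<or> rho M E1 = rho M E2"
begin

lemma visit_times_or_rates: "T1 M = T2 M \<or> mu1 M * lam2 M = mu2 M * lam1 M"
  using sym pos by (auto simp: T1_def T2_def rho_def positive_params_def frac_eq_eq mult.commute)

text \<open>When $\lambda_e=r\mu_e$, all flows caused by arrivals and visits scale with $\mu_e$. If the inflow
  of a level is proportional to $\mu_e p_E(e)$, the vector $p_E$ therefore solves its system up to
  a factor, because $p_E$ already balances the environment changes. The joining flow into the next
  level is again proportional to $\lambda_e p_E(e)=r\mu_e p_E(e)$.\<close>

lemma level_product_form:
  assumes rates: "mu1 M * lam2 M = mu2 M * lam1 M" and strat: "is_strategy s"
  shows "\<exists>c. \<forall>e. level M s n e = c * env_prob M e"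
proof -
  define r where "r = lam1 M / mu1 M"
  have r: "lam M e = r * mu M e" for e
    using rates pos by (cases e) (auto simp: r_def positive_params_def field_simps)
  have r_pos: "0 < r" using pos by (auto simp: r_def positive_params_def)
  have step: "level_solution M \<theta> (\<lambda>e. c * (mu M e * env_prob M e))
      = (\<lambda>e. c / (1 + r * \<theta>) * env_prob M e)" if "0 \<le> \<theta>" for c \<theta>
  proof -
    have nz: "1 + r * \<theta> \<noteq> 0"
      using that r_pos by (smt (verit) mult_nonneg_nonneg)
    define k where "k = c / (1 + r * \<theta>)"
    have c: "c = k * (1 + r * \<theta>)" using nz by (simp add: k_def)
    have "level_balance M \<theta> (\<lambda>e. c * (mu M e * env_prob M e)) (\<lambda>e. k * env_prob M e)"
      unfolding level_balance_def
    proof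
      fix e
      show "total_rate M \<theta> e * (k * env_prob M e) = c * (mu M e * env_prob M e)
          + leave_rate M (other e) * (k * env_prob M (other e))"
        using env_prob_balance[of e] unfolding c total_rate_def r by algebra
    qed
    then show ?thesis using that by (simp add: level_balance_iff k_def)
  qed
  show ?thesis
  proof (induction n)
    case 0
    have "level M s 0 = (\<lambda>e. 1 / (1 + r * s 0) * env_prob M e)"
      using step[of "s 0" 1] is_strategyD[OF strat] by simp
    then show ?case by metis
  next
    case (Suc n)
    then obtain c where c: "\<forall>e. level M s n e = c * env_prob M e" by blast
    have "level M s (Suc n) = level_solution M (s (Suc n))
        (\<lambda>e. (r * s n * c) * (mu M e * env_prob M e))"
      by (simp add: c r mult_ac)
    also have "\<dots> = (\<lambda>e. (r * s n * c) / (1 + r * s (Suc n)) * env_prob M e)"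
      using is_strategyD[OF strat] by (intro step)
    finally show ?case by metis
  qed
qed

lemma S_ao_eq_common_benefit:
  assumes strat: "is_strategy s" and arr: "0 < arrival_prob M s n"
  shows "S_ao M n s = common_benefit M"
proof -
  have w: "0 < arrival_weight M s n"
    using arr arrival_rate_pos by (simp add: arrival_prob_eq[OF strat] zero_less_divide_iff)
  have proportional: "lam1 M * level M s n E1 * (lam2 M * pE2 M)
        = lam2 M * level M s n E2 * (lam1 M * pE1 M)"
    if rates: "mu1 M * lam2 M = mu2 M * lam1 M"
  proof -
    obtain c where "\<forall>e. level M s n e = c * env_prob M e"
      using level_product_form[OF rates strat] by blast
    then show ?thesis by simp
  qed
  show ?thesis
    unfolding S_ao_def common_benefit_def pmf_p_ao[OF strat]
    using visit_times_or_rates proportional w arrival_rate_pos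
    by (subst weighted_mean_eq[of "T1 M" "T2 M" _ "lam2 M * pE2 M" _ "lam1 M * pE1 M"])
      (auto simp: arrival_weight_def pmf_p_ao[OF strat])
qed

text \<open>At $n=0$ only the sums $A_1+B_1$ and $A_2+B_2$ enter. They are the probabilities of the two empty
  states when everybody joins, so $H^U(0)$ is the net benefit at queue length \<open>0\<close> in that case.
  Here $z_1,z_2$ are eliminated directly: they are the roots of
  $\lambda_1\lambda_2z^2+(\lambda_1(\mu_2+q_{21})+\lambda_2(\mu_1+q_{12}))z+K$, whose value at $1$
  is the determinant of a level with joining probability \<open>1\<close>.\<close>

lemma H_U_0_eq_common_benefit: "H_U M 0 = common_benefit M"
proof -
  define d L where "d = sqrt (Delta M)" and "L = lam1 M * lam2 M"
  define P where "P = total_rate M 1 E1 * total_rate M 1 E2 - q12 M * q21 M"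
  define S where "S = lam1 M * (mu2 M + q21 M) + lam2 M * (mu1 M + q12 M)"
  note p = pos[unfolded positive_params_def]
  have L: "L > 0" using p by (simp add: L_def)
  have "Delta M > 0"
    unfolding Delta_def using p by (intro add_nonneg_pos) auto
  then have d: "d > 0" "d * d = Delta M" by (simp_all add: d_def)
  have P: "P > 0" unfolding P_def by (rule level_det_pos) simp
  have z: "2 * L * z1 M = d - S" "2 * L * z2 M = - S - d"
    using L by (simp_all add: z1_def z2_def flip: d_def L_def) (simp_all add: L_def S_def d_def)
  \<comment> \<open>From here on \<open>z1\<close> and \<open>z2\<close> enter only through \<open>gap\<close> and \<open>char\<close>.\<close>
  have gap: "L * (z1 M - z2 M) = d" using z by (simp add: algebra_simps)
  have "4 * L * (L * ((1 - z1 M) * (1 - z2 M))) = (2 * L - (d - S)) * (2 * L - (- S - d))"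
    unfolding z[symmetric] by algebra
  also have "\<dots> = (2 * L + S)\<^sup>2 - Delta M" unfolding d(2)[symmetric] by algebra
  also have "\<dots> = 4 * L * P"
    unfolding Delta_def S_def L_def P_def total_rate_def by (simp; algebra)
  finally have char: "L * ((1 - z1 M) * (1 - z2 M)) = P" using L by simp
  then have z_ne: "1 - z1 M \<noteq> 0" "1 - z2 M \<noteq> 0" using P by auto
  have split: "(a * z1 M + K M) * q / (d * (1 - z1 M)) + - ((a * z2 M + K M) * q / (d * (1 - z2 M)))
      = (a + K M) * q / P" for a q
  proof -
    have frac: "x / (d * u) + - (y / (d * v)) = (x * v - y * u) / (d * (u * v))"
      if "u \<noteq> 0" "v \<noteq> 0" for x y u v
      using that d(1) by (simp add: field_simps)
    have "((a * z1 M + K M) * q * (1 - z2 M) - (a * z2 M + K M) * q * (1 - z1 M))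
        = q * (a + K M) * (z1 M - z2 M)"
      by algebra
    then have "(a * z1 M + K M) * q / (d * (1 - z1 M)) + - ((a * z2 M + K M) * q / (d * (1 - z2 M)))
      = L * (q * (a + K M) * (z1 M - z2 M)) / (L * (d * ((1 - z1 M) * (1 - z2 M))))"
      using frac[OF z_ne] L by simp
    also have "\<dots> = q * (a + K M) * (L * (z1 M - z2 M)) / (d * (L * ((1 - z1 M) * (1 - z2 M))))"
      by (simp only: mult_ac)
    finally show ?thesis unfolding gap char using d by simp
  qed
  \<comment> \<open>The weights of the two environments at queue length \<open>0\<close>, when everybody joins.\<close>
  define x1 x2 where "x1 = lam1 M * (A1 M + B1 M)" and "x2 = lam2 M * (A2 M + B2 M)"
  have x1: "x1 = lam1 M * ((mu1 M * lam2 M + K M) * pE1 M / P)"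
    unfolding x1_def A1_def B1_def by (simp only: split flip: d_def)
  have x2: "x2 = lam2 M * ((mu2 M * lam1 M + K M) * pE2 M / P)"
    unfolding x2_def A2_def B2_def by (simp only: split flip: d_def)
  have K_pos: "K M > 0" using p by (simp add: K_def add_pos_pos)
  have pE: "pE1 M > 0" "pE2 M > 0" using rates_pos(4)[of E1] rates_pos(4)[of E2] by simp_all
  have "x1 > 0" "x2 > 0"
    unfolding x1 x2 using p K_pos pE P by (auto intro!: mult_pos_pos divide_pos_pos add_pos_pos)
  then have x: "x1 + x2 \<noteq> 0" by simp
  \<comment> \<open>The factors \<open>mu1 M * lam2 M + K M\<close> and \<open>mu2 M * lam1 M + K M\<close> agree when the load ratios do.\<close>
  have proportional: "x1 * (lam2 M * pE2 M) = x2 * (lam1 M * pE1 M)"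
    if "mu1 M * lam2 M = mu2 M * lam1 M"
    unfolding x1 x2 that by simp
  have num: "reward M * coeff_D M - cost M * coeff_A M + (reward M * coeff_E M - cost M * coeff_B M)
      = reward M * (x1 + x2) - cost M * (x1 * T1 M + x2 * T2 M)"
    unfolding coeff_A_def coeff_B_def coeff_D_def coeff_E_def x1_def x2_def by algebra
  have den: "coeff_D M + coeff_E M = x1 + x2"
    unfolding coeff_D_def coeff_E_def x1_def x2_def by algebra
  have "H_U M 0 = reward M - cost M * ((x1 * T1 M + x2 * T2 M) / (x1 + x2))"
    unfolding H_U_def power_0 mult_1_right num den using x by (simp add: diff_divide_distrib)
  also have "(x1 * T1 M + x2 * T2 M) / (x1 + x2)
      = (lam1 M * pE1 M * T1 M + lam2 M * pE2 M * T2 M) / (lam1 M * pE1 M + lam2 M * pE2 M)"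
    by (rule weighted_mean_eq) (use visit_times_or_rates proportional x arrival_rate_pos in auto)
  finally show ?thesis by (simp add: common_benefit_def)
qed

section \<open>Equilibria\<close>

context
  fixes s :: strategy
  assumes strat: "is_strategy s"
begin

lemma payoff_eq:
  "payoff M s' s = (\<Sum>\<^sub>\<infinity>n. common_benefit M * (arrival_prob M s n * s' n))"
  unfolding payoff_def
proof (rule infsum_cong_neutral)
  fix n
  assume "n \<in> UNIV - {n. arrival_prob M s n > 0}"
  then have "arrival_prob M s n = 0"
    using arrival_prob_nonneg[OF strat, of n] by auto
  then show "common_benefit M * (arrival_prob M s n * s' n) = 0" by simp
qed (auto simp: S_ao_eq_common_benefit[OF strat])

lemma payoff_summable:
  assumes "is_strategy s'"
  shows "(\<lambda>n. common_benefit M * (arrival_prob M s n * s' n)) summable_on UNIV"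
  by (intro summable_on_cmult_right, rule summable_on_comparison_test[OF arrival_prob_summable[OF strat]])
    (auto simp: arrival_prob_nonneg[OF strat] is_strategyD[OF assms] mult_left_le)

lemma equilibrium_if_indifferent: "common_benefit M = 0 \<Longrightarrow> equilibrium M s"
  using strat by (simp add: equilibrium_def payoff_eq)

text \<open>Each queue length contributes a separate term to the payoff, and its best reply does not depend on
  the length. The loss against that reply is a sum of nonnegative terms, so it vanishes only if
  every term does.\<close>

lemma equilibrium_iff_best_at_arrivals:
  assumes "common_benefit M \<noteq> 0"
  shows "equilibrium M s \<longleftrightarrow>
    (\<forall>n. 0 < arrival_prob M s n \<longrightarrow> s n = (if 0 < common_benefit M then 1 else 0))"
proof -
  define b where "b = (if 0 < common_benefit M then 1 else 0 :: real)"
  \<comment> \<open>\<open>b\<close> is the decision that is optimal at every queue length at once.\<close>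
  have best: "common_benefit M * (arrival_prob M s n * s' n)
      \<le> common_benefit M * (arrival_prob M s n * b)"
    if "is_strategy s'" for s' n
  proof (cases "0 < common_benefit M")
    case True
    then show ?thesis
      using arrival_prob_nonneg[OF strat, of n] is_strategyD[OF that, of n]
      by (auto simp: b_def intro!: mult_left_le)
  next
    case False
    then show ?thesis
      using arrival_prob_nonneg[OF strat, of n] is_strategyD[OF that, of n]
      by (auto simp: b_def intro!: mult_nonpos_nonneg)
  qed
  have b: "is_strategy (\<lambda>_. b)" by (simp add: is_strategy_def b_def)
  show ?thesis unfolding b_def[symmetric]
  proof (intro iffI allI impI)
    fix n
    assume eq: "equilibrium M s" and arr: "0 < arrival_prob M s n"
    define gain where "gain = (\<lambda>s' n. common_benefit M * (arrival_prob M s n * s' n))"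
    define loss where "loss = (\<lambda>n. gain (\<lambda>_. b) n + - gain s n)"
    have gain_summable: "gain (\<lambda>_. b) summable_on UNIV" "(\<lambda>n. - gain s n) summable_on UNIV"
      using payoff_summable[OF b] payoff_summable[OF strat]
      by (simp_all add: gain_def summable_on_uminus)
    have loss_summable: "loss summable_on UNIV"
      unfolding loss_def by (intro summable_on_add gain_summable)
    have "infsum loss UNIV = payoff M (\<lambda>_. b) s - payoff M s s"
      unfolding loss_def infsum_add[OF gain_summable] payoff_eq by (simp add: infsum_uminus gain_def)
    also have "\<dots> \<le> 0" using eq b by (simp add: equilibrium_def)
    finally have "loss n = 0"
      by (rule nonneg_infsum_le_0D[OF _ loss_summable]) (use best[OF strat] in \<open>auto simp: loss_def gain_def\<close>)
    then show "s n = b" using arr assms by (simp add: loss_def gain_def)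
  next
    assume at_arrivals: "\<forall>n. 0 < arrival_prob M s n \<longrightarrow> s n = b"
    have same: "arrival_prob M s n * s n = arrival_prob M s n * b" for n
      using at_arrivals arrival_prob_nonneg[OF strat, of n] by (cases "arrival_prob M s n = 0") auto
    have "payoff M s' s \<le> payoff M s s" if "is_strategy s'" for s'
      unfolding payoff_eq
      by (rule infsum_mono[OF payoff_summable[OF that] payoff_summable[OF strat]])
        (simp only: same best[OF that])
    then show "equilibrium M s" using strat by (simp add: equilibrium_def)
  qed
qed

text \<open>By induction every queue length occurs: joining is certain at all shorter ones, because they occur.
  So no freedom is left at lengths that are never seen.\<close>

lemma equilibrium_iff_always_join:
  assumes "0 < common_benefit M"
  shows "equilibrium M s \<longleftrightarrow> s = threshold_inf"
proof
  assume "equilibrium M s"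
  then have one: "s n = 1" if "0 < arrival_prob M s n" for n
    using that assms by (simp add: equilibrium_iff_best_at_arrivals)
  have "s n = 1" for n
  proof (induction n rule: less_induct)
    case (less n)
    then have "0 < arrival_prob M s n"
      by (intro arrival_prob_pos[OF strat]) simp
    then show ?case by (rule one)
  qed
  then show "s = threshold_inf" by (simp add: threshold_inf_def fun_eq_iff)
next
  assume "s = threshold_inf"
  then show "equilibrium M s"
    using assms by (subst equilibrium_iff_best_at_arrivals) (auto simp: threshold_inf_def)
qed

lemma equilibrium_balks_when_empty:
  assumes "common_benefit M < 0" "equilibrium M s"
  shows "s 0 = 0"
  using assms arrival_prob_pos[OF strat, of 0] by (simp add: equilibrium_iff_best_at_arrivals)

end

lemma always_balk_equilibrium:
  assumes "common_benefit M < 0"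
  shows "equilibrium M (threshold 0 0)"
  using assms by (subst equilibrium_iff_best_at_arrivals) (auto simp: is_strategy_def threshold_def)

end

end

lemma is_strategy_threshold_classes:
  "s \<in> threshold_strategies \<union> rev_threshold_strategies \<Longrightarrow> is_strategy s"
  by (auto simp: threshold_strategies_def rev_threshold_strategies_def is_strategy_def
      threshold_def threshold_inf_def rev_threshold_def rev_threshold_inf_def)

lemma S_rt_subset: "S_rt \<subseteq> rev_threshold_strategies"
  by (force simp: S_rt_def rev_threshold_strategies_def)

text \<open>This needs the restricted reverse class: \<open>rev_threshold 1 1\<close> also balks at \<open>0\<close>.\<close>

lemma threshold_class_balks_when_empty:
  assumes "s \<in> threshold_strategies \<union> S_rt" "s 0 = 0"
  shows "s = threshold 0 0"
  using assms
  by (auto simp: threshold_strategies_def S_rt_def threshold_def threshold_inf_def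
      rev_threshold_def rev_threshold_inf_def fun_eq_iff split: if_splits)

theorem theorem5p3:
  fixes M :: clearing_model
  assumes "positive_params M"
    and "mu M E1 = mu M E2 \<or> rho M E1 = rho M E2"
  shows "(\<exists>s \<in> threshold_strategies \<union> S_rt. equilibrium M s)
    \<and> (H_U M 0 < 0 \<longrightarrow>
        {s \<in> threshold_strategies \<union> S_rt. equilibrium M s} = {threshold 0 0})
    \<and> (H_U M 0 = 0 \<longrightarrow>
        (\<forall>s \<in> threshold_strategies \<union> rev_threshold_strategies. equilibrium M s))
    \<and> (H_U M 0 > 0 \<longrightarrow>
        {s \<in> threshold_strategies \<union> rev_threshold_strategies. equilibrium M s}
          = {threshold_inf})"
proof -
  have H: "H_U M 0 = common_benefit M"
    by (rule H_U_0_eq_common_benefit[OF assms])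
  have balk_in: "threshold 0 0 \<in> threshold_strategies"
    by (force simp: threshold_strategies_def)
  have join_in: "threshold_inf \<in> threshold_strategies"
    by (simp add: threshold_strategies_def)
  have strat: "is_strategy s" if "s \<in> threshold_strategies \<union> S_rt" for s
    using that S_rt_subset is_strategy_threshold_classes by blast
  have I: "{s \<in> threshold_strategies \<union> S_rt. equilibrium M s} = {threshold 0 0}"
    if neg: "H_U M 0 < 0"
  proof -
    have neg': "common_benefit M < 0" using neg H by simp
    have "s = threshold 0 0" if "s \<in> threshold_strategies \<union> S_rt" "equilibrium M s" for s
      using threshold_class_balks_when_empty[OF that(1)]
        equilibrium_balks_when_empty[OF assms strat[OF that(1)] neg' that(2)] by blast
    then show ?thesis
      using always_balk_equilibrium[OF assms neg'] balk_in by blast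
  qed
  have II: "equilibrium M s"
    if "H_U M 0 = 0" "s \<in> threshold_strategies \<union> rev_threshold_strategies" for s
    using equilibrium_if_indifferent[OF assms is_strategy_threshold_classes[OF that(2)]] that(1) H
    by simp
  have III: "{s \<in> threshold_strategies \<union> rev_threshold_strategies. equilibrium M s}
      = {threshold_inf}" if "H_U M 0 > 0"
  proof -
    have "equilibrium M s \<longleftrightarrow> s = threshold_inf"
      if "s \<in> threshold_strategies \<union> rev_threshold_strategies" for s
      using equilibrium_iff_always_join[OF assms is_strategy_threshold_classes[OF that]]
        \<open>H_U M 0 > 0\<close> H by simp
    then show ?thesis using join_in by blast
  qed
  have "\<exists>s \<in> threshold_strategies \<union> S_rt. equilibrium M s"
  proof (cases "H_U M 0" "0 :: real" rule: linorder_cases)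
    case less
    then show ?thesis using I by blast
  next
    case equal
    then show ?thesis using II balk_in by blast
  next
    case greater
    then have "equilibrium M threshold_inf" using III by blast
    then show ?thesis using join_in by blast
  qed
  with I II III show ?thesis by blast
qed

end
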